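(* Consider the Riemann problem for the homogeneous one-dimensional ten-moment equations with left and right states $\mathbf V_L,\mathbf V_R$, and its solution consisting of constant states separated by a 1-wave (shock or rarefaction), a 2-shear wave, a 3,4-contact discontinuity, a 5-shear wave and a 6-wave (shock or rarefaction), with $u_1=u_{1,\ast}$ and $p_{11}=p_{11,\ast}$ constant in the whole region between the 1-wave and the 6-wave. Then the pressure component $p_{11,\ast}$ is given by the root of the algebraic equation $$f(p_{11},\mathbf V_L,\mathbf V_R):=f_L(p_{11},\mathbf V_L)+f_R(p_{11},\mathbf V_R)+u_{1,R}-u_{1,L}=0,$$ where, for $K=L,R$, $$f_K(p_{11},\mathbf V_K)=\begin{cases}(p_{11}-p_{11,K})\left[\dfrac{1}{\rho_K(2p_{11}+p_{11,K})}\right]^{1/2}, & p_{11}>p_{11,K}\ (\text{shock}),\\[2mm] c_K\left[\left(\dfrac{p_{11}}{p_{11,K}}\right)^{1/3}-1\right], & p_{11}\le p_{11,K}\ (\text{rarefaction}),\end{cases}$$ (the wave being the 1-wave for $K=L$ and the 6-wave for $K=R$). Moreover the velocity $u_{1,\ast}$ is given by $$u_{1,\ast}=\tfrac12(u_{1,L}+u_{1,R})+\tfrac12\left[f_R(p_{11,\ast},\mathbf V_R)-f_L(p_{11,\ast},\mathbf V_L)\right].$$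
   Context: The unknown is $\mathbf V=(\rho,u_1,u_2,p_{11},p_{12},p_{22})^\top$ with $\rho>0$, $p_{11}>0$, $p_{11}p_{22}-p_{12}^2>0$. Put $E_{ij}=\tfrac12(\rho u_iu_j+p_{ij})$, $c=\sqrt{3p_{11}/\rho}$, $c_K=\sqrt{3p_{11,K}/\rho_K}$, $\mathbf U=(\rho,\rho u_1,\rho u_2,E_{11},E_{12},E_{22})^\top$ and $$\mathbf F(\mathbf U)=\left(\rho u_1,\ \rho u_1^2+p_{11},\ \rho u_1u_2+p_{12},\ (E_{11}+p_{11})u_1,\ E_{12}u_1+\tfrac12(p_{11}u_2+p_{12}u_1),\ E_{22}u_1+p_{12}u_2\right)^\top.$$ The Riemann problem is $\partial_t\mathbf U+\partial_x\mathbf F(\mathbf U)=0$, $t>0$, with $\mathbf V(x,0)=\mathbf V_L$ for $x<0$ and $\mathbf V(x,0)=\mathbf V_R$ for $x>0$ ($\mathbf V_K=(\rho_K,u_{1,K},u_{2,K},p_{11,K},p_{12,K},p_{22,K})^\top$). The eigenvalues are $u_1-c$, $u_1-c/\sqrt3$, $u_1$ (double), $u_1+c/\sqrt3$, $u_1+c$; fields 1 and 6 are genuinely nonlinear, the others linearly degenerate. The solution is self-similar. The 1-wave (6-wave) is a shock iff $p_{11,\ast}>p_{11,L}$ ($p_{11,\ast}>p_{11,R}$) and otherwise a rarefaction. Shocks satisfy the Rankine–Hugoniot conditions and the entropy (compressivity) condition. Across the 1-rarefaction $p_{11}/\rho^3$, $p_{12}/\rho^3$, $u_1+c$, $u_2+\sqrt3p_{12}/\sqrt{\rho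 p_{11}}$, $(p_{11}p_{22}-p_{12}^2)/\rho^4$ are constant; across the 6-rarefaction $p_{11}/\rho^3$, $p_{12}/\rho^3$, $u_1-c$, $u_2-\sqrt3p_{12}/\sqrt{\rho p_{11}}$, $(p_{11}p_{22}-p_{12}^2)/\rho^4$ are constant. Across the shear waves and the contact, $u_1$ and $p_{11}$ are continuous. All states, including the middle ones, satisfy $\rho>0$, $p_{11}>0$. *)

theory Defs
  imports "HOL-Analysis.Analysis"
begin

datatype state =
  State (rho: real) (u1: real) (u2: real) (p11: real) (p12: real) (p22: real)

definition admissible :: "state \<Rightarrow> bool" where
  "admissible V \<longleftrightarrow> rho V > 0 \<and> p11 V > 0 \<and> p11 V * p22 V - (p12 V)\<^sup>2 > 0"

definition E11 :: "state \<Rightarrow> real" where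
  "E11 V = (rho V * u1 V * u1 V + p11 V) / 2"

definition E12 :: "state \<Rightarrow> real" where
  "E12 V = (rho V * u1 V * u2 V + p12 V) / 2"

definition E22 :: "state \<Rightarrow> real" where
  "E22 V = (rho V * u2 V * u2 V + p22 V) / 2"

text \<open>The conserved variables \<open>U\<close> and the flux \<open>F(U)\<close>, both as functions of the
  primitive variables.\<close>

definition conserved :: "state \<Rightarrow> real ^ 6" where
  "conserved V = vector [rho V, rho V * u1 V, rho V * u2 V, E11 V, E12 V, E22 V]"

definition flux :: "state \<Rightarrow> real ^ 6" where
  "flux V = vector
    [rho V * u1 V,
     rho V * (u1 V)\<^sup>2 + p11 V,
     rho V * u1 V * u2 V + p12 V,
     (E11 V + p11 V) * u1 V,
     E12 V * u1 V + (p11 V * u2 V + p12 V * u1 V) / 2,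
     E22 V * u1 V + p12 V * u2 V]"

definition sound_speed :: "state \<Rightarrow> real" where
  "sound_speed V = sqrt (3 * p11 V / rho V)"

text \<open>The six characteristic speeds are \<open>lambda1\<close>, \<open>lambda2\<close>, \<open>u1\<close> (double),
  \<open>lambda5\<close> and \<open>lambda6\<close>.\<close>

definition lambda1 :: "state \<Rightarrow> real" where
  "lambda1 V = u1 V - sound_speed V"

definition lambda2 :: "state \<Rightarrow> real" where
  "lambda2 V = u1 V - sound_speed V / sqrt 3"

definition lambda5 :: "state \<Rightarrow> real" where
  "lambda5 V = u1 V + sound_speed V / sqrt 3"

definition lambda6 :: "state \<Rightarrow> real" where
  "lambda6 V = u1 V + sound_speed V"

definition pde_at :: "(real \<Rightarrow> real \<Rightarrow> state) \<Rightarrow> real \<Rightarrow> real \<Rightarrow> bool" where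
  "pde_at V x t \<longleftrightarrow> (\<exists>dU dF.
     ((\<lambda>\<tau>. conserved (V x \<tau>)) has_vector_derivative dU) (at t) \<and>
     ((\<lambda>y. flux (V y t)) has_vector_derivative dF) (at x) \<and>
     dU + dF = 0)"

definition rankine_hugoniot :: "real \<Rightarrow> state \<Rightarrow> state \<Rightarrow> bool" where
  "rankine_hugoniot s Vl Vr \<longleftrightarrow>
     flux Vr - flux Vl = s *\<^sub>R (conserved Vr - conserved Vl)"

text \<open>Shocks of the genuinely nonlinear field with characteristic speed \<open>lam\<close>
  (\<open>lambda1\<close> or \<open>lambda6\<close>). The entropy condition is the compressivity
  condition of Lax: the characteristics of the field run into the shock from both sides.\<close>

definition shock :: "(state \<Rightarrow> real) \<Rightarrow> real \<Rightarrow> state \<Rightarrow> state \<Rightarrow> bool" where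
  "shock lam s Vl Vr \<longleftrightarrow> rankine_hugoniot s Vl Vr \<and> lam Vl > s \<and> s > lam Vr"

definition invariants1 :: "state \<Rightarrow> real \<times> real \<times> real \<times> real \<times> real" where
  "invariants1 V =
    (p11 V / rho V ^ 3,
     p12 V / rho V ^ 3,
     u1 V + sound_speed V,
     u2 V + sqrt 3 * p12 V / sqrt (rho V * p11 V),
     (p11 V * p22 V - (p12 V)\<^sup>2) / rho V ^ 4)"

definition invariants6 :: "state \<Rightarrow> real \<times> real \<times> real \<times> real \<times> real" where
  "invariants6 V =
    (p11 V / rho V ^ 3,
     p12 V / rho V ^ 3,
     u1 V - sound_speed V,
     u2 V - sqrt 3 * p12 V / sqrt (rho V * p11 V),
     (p11 V * p22 V - (p12 V)\<^sup>2) / rho V ^ 4)"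

text \<open>A centred rarefaction fan filling the sector \<open>a \<le> \<xi> \<le> b\<close> of the profile
  \<open>W\<close>, where \<open>\<xi> = x / t\<close>. A wave of strength zero is included as the case \<open>a = b\<close>.\<close>

definition rarefaction ::
  "(state \<Rightarrow> real) \<Rightarrow> (state \<Rightarrow> real \<times> real \<times> real \<times> real \<times> real) \<Rightarrow>
   (real \<Rightarrow> state) \<Rightarrow> real \<Rightarrow> real \<Rightarrow> state \<Rightarrow> state \<Rightarrow> bool" where
  "rarefaction lam RI W a b Vl Vr \<longleftrightarrow>
     a \<le> b \<and> lam Vl = a \<and> lam Vr = b \<and> RI Vr = RI Vl \<and>
     (\<forall>\<xi>\<in>{a..b}. lam (W \<xi>) = \<xi> \<and> RI (W \<xi>) = RI Vl)"

text \<open>The wave of a genuinely nonlinear field; a shock occupies the degenerate sector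
  \<open>a = b\<close>.\<close>

definition nonlinear_wave ::
  "(state \<Rightarrow> real) \<Rightarrow> (state \<Rightarrow> real \<times> real \<times> real \<times> real \<times> real) \<Rightarrow>
   (real \<Rightarrow> state) \<Rightarrow> real \<Rightarrow> real \<Rightarrow> state \<Rightarrow> state \<Rightarrow> bool" where
  "nonlinear_wave lam RI W a b Vl Vr \<longleftrightarrow>
     (a = b \<and> shock lam a Vl Vr) \<or> rarefaction lam RI W a b Vl Vr"

text \<open>Shear waves and contacts: a discontinuity travelling with the common
  characteristic speed of the two sides. It may have strength zero.\<close>

definition degenerate_wave ::
  "(state \<Rightarrow> real) \<Rightarrow> real \<Rightarrow> state \<Rightarrow> state \<Rightarrow> bool" where
  "degenerate_wave lam s Vl Vr \<longleftrightarrow>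
     rankine_hugoniot s Vl Vr \<and> lam Vl = s \<and> lam Vr = s"

text \<open>\<open>V x t\<close> solves the Riemann problem with data \<open>V_L\<close>, \<open>V_R\<close> and has the five-wave
  structure with normal velocity \<open>u1s\<close> and pressure component \<open>p11s\<close> in the middle region.
  The equations hold classically off finitely many rays \<open>x = s t\<close>; on these rays either
  the Rankine--Hugoniot condition holds or the solution is continuous (edges of fans).
  Values of \<open>V\<close> on the discontinuities are arbitrary up to positivity.\<close>

definition riemann_solution ::
  "(real \<Rightarrow> real \<Rightarrow> state) \<Rightarrow> state \<Rightarrow> state \<Rightarrow> real \<Rightarrow> real \<Rightarrow> bool" where
  "riemann_solution V V_L V_R u1s p11s \<longleftrightarrow>
     (\<forall>x<0. V x 0 = V_L) \<and> (\<forall>x>0. V x 0 = V_R) \<and>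
     (\<exists>W V1 V2 V3 V4 a1 b1 s2 s3 s5 a6 b6.
        (\<forall>x. \<forall>t>0. V x t = W (x / t)) \<and>
        (\<forall>x. \<forall>t>0. x / t \<notin> {a1, b1, s2, s3, s5, a6, b6} \<longrightarrow> pde_at V x t) \<and>
        (\<forall>\<xi>. rho (W \<xi>) > 0 \<and> p11 (W \<xi>) > 0) \<and>
        a1 \<le> b1 \<and> b1 < s2 \<and> s2 < s3 \<and> s3 < s5 \<and> s5 < a6 \<and> a6 \<le> b6 \<and>
        (\<forall>\<xi><a1. W \<xi> = V_L) \<and>
        (\<forall>\<xi>\<in>{b1<..<s2}. W \<xi> = V1) \<and>
        (\<forall>\<xi>\<in>{s2<..<s3}. W \<xi> = V2) \<and>
        (\<forall>\<xi>\<in>{s3<..<s5}. W \<xi> = V3) \<and>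
        (\<forall>\<xi>\<in>{s5<..<a6}. W \<xi> = V4) \<and>
        (\<forall>\<xi>>b6. W \<xi> = V_R) \<and>
        nonlinear_wave lambda1 invariants1 W a1 b1 V_L V1 \<and>
        degenerate_wave lambda2 s2 V1 V2 \<and>
        degenerate_wave u1 s3 V2 V3 \<and>
        degenerate_wave lambda5 s5 V3 V4 \<and>
        nonlinear_wave lambda6 invariants6 W a6 b6 V4 V_R \<and>
        (\<forall>Z\<in>{V1, V2, V3, V4}. u1 Z = u1s \<and> p11 Z = p11s))"

definition f_wave :: "real \<Rightarrow> state \<Rightarrow> real" where
  "f_wave p V_K =
     (if p > p11 V_K
      then (p - p11 V_K) * sqrt (1 / (rho V_K * (2 * p + p11 V_K)))
      else sound_speed V_K * (root 3 (p / p11 V_K) - 1))"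

definition f_riemann :: "real \<Rightarrow> state \<Rightarrow> state \<Rightarrow> real" where
  "f_riemann p V_L V_R = f_wave p V_L + f_wave p V_R + u1 V_R - u1 V_L"

end

theory Submission
  imports Defs
begin

text \<open>
  The normal velocity and the pressure component \<open>p\<^sub>1\<^sub>1\<close> do not change between the two
  nonlinear waves, so each of these waves by itself expresses \<open>u\<^sub>1\<^sub>,\<^sub>*\<close> through
  \<open>p\<^sub>1\<^sub>1\<^sub>,\<^sub>*\<close> and the outer state next to it: \<open>u\<^sub>1\<^sub>,\<^sub>* = u\<^sub>1\<^sub>,\<^sub>L - f\<^sub>L\<close> from the 1-wave and
  \<open>u\<^sub>1\<^sub>,\<^sub>* = u\<^sub>1\<^sub>,\<^sub>R + f\<^sub>R\<close> from the 6-wave. The difference of the two equations is the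
  algebraic equation for \<open>p\<^sub>1\<^sub>1\<^sub>,\<^sub>*\<close>, and half their sum is the formula for the velocity.

  The reflection \<open>x \<mapsto> -x\<close> exchanges the two nonlinear fields. Both are therefore treated
  together: \<open>K\<close> is the outer state, \<open>Z\<close> the state on the inner side of the wave, and the sign
  \<open>\<sigma>\<close> is \<open>1\<close> for the 1-wave and \<open>-1\<close> for the 6-wave. In both cases the claim is
  \<open>u\<^sub>1 Z = u\<^sub>1 K - \<sigma> f\<^sub>K (p\<^sub>1\<^sub>1 Z)\<close> (\<open>velocity_behind_shock\<close> and
  \<open>velocity_behind_rarefaction\<close>).

  The density, \<open>u\<^sub>1\<close> and \<open>p\<^sub>1\<^sub>1\<close> obey a closed subsystem, the one-dimensional Euler equations
  of a gas with adiabatic exponent 3. For a shock, conservation of mass, momentum and energy in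
  the frame of the shock gives the mass flux \<open>m\<close> through \<open>m\<^sup>2 = \<rho>\<^sub>K (2 p\<^sub>1\<^sub>1 Z + p\<^sub>1\<^sub>1 K)\<close>; the
  direction of the flow fixes the sign of \<open>m\<close>, and the momentum balance then gives the jump
  of the velocity. In a rarefaction \<open>p\<^sub>1\<^sub>1\<close> is proportional to \<open>\<rho>\<^sup>3\<close>, which makes the sound
  speed proportional to \<open>\<rho>\<close>, hence to the cube root of \<open>p\<^sub>1\<^sub>1\<close>, and \<open>u\<^sub>1 + \<sigma> c\<close> is constant.
  Compressivity of the shock and the expansion of the fan decide which of the two branches of
  \<open>f\<^sub>K\<close> is in force.

  The root is unique because both branches of \<open>f\<^sub>K\<close> are strictly increasing and
  they meet at the value zero (\<open>f_wave_strict_mono\<close>).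
\<close>


section \<open>Shocks\<close>

lemma rankine_hugoniot_normal_components:
  assumes "rankine_hugoniot s X Y"
  shows "rho Y * u1 Y - rho X * u1 X = s * (rho Y - rho X)"
    and "(rho Y * (u1 Y)\<^sup>2 + p11 Y) - (rho X * (u1 X)\<^sup>2 + p11 X) =
           s * (rho Y * u1 Y - rho X * u1 X)"
    and "(E11 Y + p11 Y) * u1 Y - (E11 X + p11 X) * u1 X = s * (E11 Y - E11 X)"
proof -
  have eq: "(flux Y - flux X) $ i = (s *\<^sub>R (conserved Y - conserved X)) $ i" for i
    using assms by (simp add: rankine_hugoniot_def)
  show "rho Y * u1 Y - rho X * u1 X = s * (rho Y - rho X)"
    using eq[of 1] by (simp add: flux_def conserved_def vector_def)
  show "(rho Y * (u1 Y)\<^sup>2 + p11 Y) - (rho X * (u1 X)\<^sup>2 + p11 X) =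
           s * (rho Y * u1 Y - rho X * u1 X)"
    using eq[of 2] by (simp add: flux_def conserved_def vector_def)
  show "(E11 Y + p11 Y) * u1 Y - (E11 X + p11 X) * u1 X = s * (E11 Y - E11 X)"
    using eq[of 4] by (simp add: flux_def conserved_def vector_def)
qed

lemma rankine_hugoniot_sym: "rankine_hugoniot s X Y \<longleftrightarrow> rankine_hugoniot s Y X"
proof -
  have "rankine_hugoniot s Y X" if "rankine_hugoniot s X Y" for X Y
  proof -
    have "flux X - flux Y = - (flux Y - flux X)" by simp
    also have "\<dots> = s *\<^sub>R (conserved X - conserved Y)"
      using that by (simp add: rankine_hugoniot_def algebra_simps)
    finally show ?thesis by (simp add: rankine_hugoniot_def)
  qed
  then show ?thesis by blast
qed

text \<open>
  In the frame of the shock let \<open>v = u\<^sub>1 - s\<close>. Mass, momentum and energy balance say that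
  \<open>m = \<rho> v\<close>, \<open>P = m v + p\<^sub>1\<^sub>1\<close> and \<open>m v\<^sup>2 + 3 p\<^sub>1\<^sub>1 v = 3 P v - 2 m v\<^sup>2\<close> are the same on both
  sides. The last expression is quadratic in \<open>v\<close>, so two different values of \<open>v\<close> add up to
  \<open>3 P / (2 m)\<close>; eliminating the velocity of the state \<open>Z\<close> leaves the first conclusion.
\<close>

lemma shock_jump_relations:
  assumes rh: "rankine_hugoniot s K Z" and ne: "u1 Z \<noteq> u1 K"
  shows "rho K * (u1 K - s)\<^sup>2 = 2 * p11 Z + p11 K"
    and "rho K * (u1 K - s) * (u1 Z - u1 K) = p11 K - p11 Z"
proof -
  define v w where "v = u1 K - s" and "w = u1 Z - s"
  have uK: "u1 K = v + s" and uZ: "u1 Z = w + s"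
    by (simp_all add: v_def w_def)
  note rhc = rankine_hugoniot_normal_components[OF rh, unfolded E11_def uK uZ]
  have mass: "rho Z * w = rho K * v"
    using rhc(1) by (simp add: algebra_simps)
  have momentum: "rho Z * w * w + p11 Z = rho K * v * v + p11 K"
    using rhc(2) arg_cong[OF mass, of "\<lambda>x. s * x"]
    unfolding power2_eq_square by (simp only: algebra_simps)
  have energy: "rho Z * w * w\<^sup>2 + 3 * p11 Z * w = rho K * v * v\<^sup>2 + 3 * p11 K * v"
    using rhc(3) arg_cong[OF mass, of "\<lambda>x. s\<^sup>2 * x"] arg_cong[OF momentum, of "\<lambda>x. 2 * s * x"]
    unfolding power2_eq_square
    by (simp only: algebra_simps add_divide_distrib diff_divide_distrib) argo
  define m where "m = rho K * v"
  have pZ: "p11 Z = m * v + p11 K - m * w"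
    using momentum mass by (simp add: m_def)
  have "(w - v) * (m * v + 3 * p11 K - 2 * m * w) = 0"
    using energy unfolding mass m_def[symmetric] pZ
    by (simp add: power2_eq_square algebra_simps)
  then have "m * v + 3 * p11 K = 2 * m * w"
    using ne by (simp add: uK uZ)
  then have "m * v = 2 * p11 Z + p11 K"
    using pZ by simp
  then show "rho K * (u1 K - s)\<^sup>2 = 2 * p11 Z + p11 K"
    by (simp add: m_def v_def power2_eq_square algebra_simps)
  show "rho K * (u1 K - s) * (u1 Z - u1 K) = p11 K - p11 Z"
    using pZ by (simp add: m_def uK uZ algebra_simps)
qed

text \<open>
  The outer state enters the shock at a speed above \<open>c\<^sub>K\<close>. This determines the sign of the
  mass flux and gives \<open>2 p\<^sub>1\<^sub>1 Z + p\<^sub>1\<^sub>1 K > 3 p\<^sub>1\<^sub>1 K\<close>, that is, compression. The characteristic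
  speed on the inner side serves to exclude a shock of strength zero.
\<close>

lemma velocity_behind_shock:
  assumes rh: "rankine_hugoniot s K Z"
    and pos: "rho K > 0" "p11 K > 0"
    and \<sigma>: "\<sigma> = 1 \<or> \<sigma> = - 1"
    and supersonic: "\<sigma> * (u1 K - s) > sound_speed K"
    and ne: "u1 K - \<sigma> * sound_speed K \<noteq> u1 Z - \<sigma> * sound_speed Z"
  shows "u1 Z = u1 K - \<sigma> * f_wave (p11 Z) K"
proof -
  let ?v = "\<sigma> * (u1 K - s)"
  have \<sigma>2: "\<sigma> * \<sigma> = 1" using \<sigma> by auto
  have c_pos: "sound_speed K > 0" using pos by (simp add: sound_speed_def)
  have u_ne: "u1 Z \<noteq> u1 K"
  proof
    assume eq: "u1 Z = u1 K"
    have "(rho Z - rho K) * (u1 K - s) = 0"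
      using rankine_hugoniot_normal_components(1)[OF rh] by (simp add: eq algebra_simps)
    moreover have "u1 K - s \<noteq> 0" using supersonic c_pos by auto
    ultimately have rho_eq: "rho Z = rho K" by simp
    have "p11 Z = p11 K"
      using rankine_hugoniot_normal_components(2)[OF rh] by (simp add: eq rho_eq)
    then have "sound_speed Z = sound_speed K"
      by (simp add: sound_speed_def rho_eq)
    with ne eq show False by simp
  qed
  have v_sq: "rho K * ?v\<^sup>2 = 2 * p11 Z + p11 K"
    using shock_jump_relations(1)[OF rh u_ne] \<sigma> by (auto simp: power2_commute)
  have jump: "rho K * ?v * (\<sigma> * (u1 Z - u1 K)) = p11 K - p11 Z"
    using shock_jump_relations(2)[OF rh u_ne] \<sigma> by (auto simp: algebra_simps)
  have "(sound_speed K)\<^sup>2 < ?v\<^sup>2"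
    using supersonic c_pos by (intro power_strict_mono) auto
  then have "3 * p11 K < rho K * ?v\<^sup>2"
    using pos by (simp add: sound_speed_def divide_simps mult.commute)
  then have compressed: "p11 Z > p11 K" using v_sq by simp
  have "sqrt (rho K * (2 * p11 Z + p11 K)) = sqrt ((rho K * ?v)\<^sup>2)"
    unfolding v_sq[symmetric] by (simp add: power2_eq_square algebra_simps)
  also have "\<dots> = rho K * ?v"
    using pos supersonic c_pos by (simp del: power_mult_distrib)
  finally have mass_flux: "sqrt (rho K * (2 * p11 Z + p11 K)) = rho K * ?v" .
  have m_pos: "rho K * ?v > 0" using pos supersonic c_pos by simp
  have "f_wave (p11 Z) K = (p11 Z - p11 K) / (rho K * ?v)"
    using compressed by (simp only: f_wave_def real_sqrt_divide mass_flux) simp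
  also have "\<dots> = - (\<sigma> * (u1 Z - u1 K))"
    unfolding nonzero_divide_eq_eq[OF less_imp_neq[OF m_pos, symmetric]]
    using jump by (simp only: algebra_simps minus_diff_eq)
  finally have "\<sigma> * f_wave (p11 Z) K = - ((\<sigma> * \<sigma>) * (u1 Z - u1 K))"
    by (simp only: mult.assoc mult_minus_right)
  then show ?thesis by (simp add: \<sigma>2)
qed


section \<open>Rarefactions\<close>

text \<open>
  The last hypothesis says that the characteristic speed does not decrease from left to right
  through the fan; together with the constancy of \<open>u\<^sub>1 + \<sigma> c\<close> it makes \<open>Z\<close> no denser than
  \<open>K\<close>, which selects the second branch of \<open>f_wave\<close>.
\<close>

lemma velocity_behind_rarefaction:
  assumes pos: "rho K > 0" "p11 K > 0" "rho Z > 0"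
    and \<sigma>: "\<sigma> = 1 \<or> \<sigma> = - 1"
    and isentropic: "p11 Z / rho Z ^ 3 = p11 K / rho K ^ 3"
    and invariant: "u1 Z + \<sigma> * sound_speed Z = u1 K + \<sigma> * sound_speed K"
    and expansion: "\<sigma> * (u1 Z - u1 K) \<ge> sound_speed Z - sound_speed K"
  shows "u1 Z = u1 K - \<sigma> * f_wave (p11 Z) K"
proof -
  define r where "r = rho Z / rho K"
  have r_pos: "r > 0" using pos by (simp add: r_def)
  have rhoZ: "rho Z = r * rho K" using pos by (simp add: r_def)
  have pZ: "p11 Z = r ^ 3 * p11 K"
    using isentropic pos r_pos by (simp add: rhoZ power_mult_distrib field_simps)
  have c_pos: "sound_speed K > 0" using pos by (simp add: sound_speed_def)
  have "3 * p11 Z / rho Z = r\<^sup>2 * (3 * p11 K / rho K)"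
    using pos r_pos by (simp add: rhoZ pZ power2_eq_square power3_eq_cube field_simps)
  then have cZ: "sound_speed Z = r * sound_speed K"
    using r_pos by (simp only: sound_speed_def real_sqrt_mult) simp
  have "\<sigma> * (u1 Z - u1 K) = sound_speed K - sound_speed Z"
    using invariant \<sigma> by auto
  then have "r * sound_speed K \<le> 1 * sound_speed K"
    using expansion cZ by simp
  then have r_le: "r \<le> 1" using c_pos by simp
  then have "r ^ 3 \<le> 1" using r_pos by (simp add: power_le_one)
  then have "p11 Z \<le> p11 K" using pos by (simp add: pZ)
  moreover have "root 3 (p11 Z / p11 K) = r"
    using pos r_pos by (simp add: pZ real_root_power_cancel)
  ultimately have "f_wave (p11 Z) K = sound_speed K * (r - 1)"
    by (simp add: f_wave_def)
  then have "sound_speed Z = sound_speed K + f_wave (p11 Z) K"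
    using cZ by (simp add: algebra_simps)
  then show ?thesis
    using invariant by (simp add: algebra_simps)
qed


section \<open>The two nonlinear waves\<close>

lemma velocity_behind_1_wave:
  assumes wave: "nonlinear_wave lambda1 invariants1 W a b K Z"
    and pos: "rho K > 0" "p11 K > 0" "rho Z > 0"
  shows "u1 Z = u1 K - f_wave (p11 Z) K"
  using wave unfolding nonlinear_wave_def
proof
  assume "a = b \<and> shock lambda1 a K Z"
  then show ?thesis
    using velocity_behind_shock[of a K Z 1] pos by (auto simp: shock_def lambda1_def)
next
  assume "rarefaction lambda1 invariants1 W a b K Z"
  then show ?thesis
    using velocity_behind_rarefaction[of K Z 1] pos
    by (simp add: rarefaction_def lambda1_def invariants1_def)
qed

lemma velocity_behind_6_wave:
  assumes wave: "nonlinear_wave lambda6 invariants6 W a b Z K"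
    and pos: "rho K > 0" "p11 K > 0" "rho Z > 0"
  shows "u1 Z = u1 K + f_wave (p11 Z) K"
  using wave unfolding nonlinear_wave_def
proof
  assume "a = b \<and> shock lambda6 a Z K"
  then show ?thesis
    using velocity_behind_shock[of a K Z "- 1"] pos rankine_hugoniot_sym[of a Z K]
    by (auto simp: shock_def lambda6_def)
next
  assume "rarefaction lambda6 invariants6 W a b Z K"
  then show ?thesis
    using velocity_behind_rarefaction[of K Z "- 1"] pos
    by (simp add: rarefaction_def lambda6_def invariants6_def)
qed


section \<open>Uniqueness of the root\<close>

lemma f_wave_strict_mono:
  assumes pos: "rho K > 0" "p11 K > 0" and p: "0 < p" "p < q"
  shows "f_wave p K < f_wave q K"
proof -
  let ?a = "p11 K"
  have c_pos: "sound_speed K > 0" using pos by (simp add: sound_speed_def)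
  consider (shock) "?a < p" | (mixed) "p \<le> ?a" "?a < q" | (rarefaction) "q \<le> ?a"
    by linarith
  then show ?thesis
  proof cases
    case shock
    (* With x = p - a and y = q - a the squares are compared after clearing denominators. *)
    define x y where "x = p - ?a" and "y = q - ?a"
    have xy: "0 < x" "x < y" using shock p by (simp_all add: x_def y_def)
    have "x\<^sup>2 * (2 * y + 3 * ?a) = 2 * (x * y) * x + 3 * ?a * x\<^sup>2"
      by algebra
    also have "\<dots> < 2 * (x * y) * y + 3 * ?a * y\<^sup>2"
      using xy pos by (intro add_strict_mono mult_strict_left_mono power_strict_mono) auto
    also have "\<dots> = y\<^sup>2 * (2 * x + 3 * ?a)"
      by algebra
    finally have cross: "(p - ?a)\<^sup>2 * (2 * q + ?a) < (q - ?a)\<^sup>2 * (2 * p + ?a)"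
      by (simp add: x_def y_def algebra_simps)
    have square: "((t - ?a) * sqrt (1 / (rho K * (2 * t + ?a))))\<^sup>2 =
        (t - ?a)\<^sup>2 / (2 * t + ?a) / rho K" if "t > ?a" for t
      using that pos by (simp add: power_mult_distrib mult.commute)
    have "(p - ?a)\<^sup>2 / (2 * p + ?a) < (q - ?a)\<^sup>2 / (2 * q + ?a)"
      using cross shock p pos by (simp add: divide_simps)
    then have "((p - ?a) * sqrt (1 / (rho K * (2 * p + ?a))))\<^sup>2 <
        ((q - ?a) * sqrt (1 / (rho K * (2 * q + ?a))))\<^sup>2"
      using shock p pos by (simp only: square less_trans[OF shock p(2)] divide_strict_right_mono)
    then have "(p - ?a) * sqrt (1 / (rho K * (2 * p + ?a))) <
        (q - ?a) * sqrt (1 / (rho K * (2 * q + ?a)))"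
      by (rule power2_less_imp_less) (use shock p pos in simp)
    then show ?thesis using shock p by (simp add: f_wave_def)
  next
    case mixed
    have "root 3 (p / ?a) \<le> 1" using mixed pos by simp
    then have "f_wave p K \<le> 0"
      using mixed c_pos by (simp add: f_wave_def mult_nonneg_nonpos)
    also have "0 < f_wave q K"
      using mixed pos by (simp add: f_wave_def)
    finally show ?thesis .
  next
    case rarefaction
    have "p / ?a < q / ?a" using p pos by (simp add: divide_strict_right_mono)
    then show ?thesis
      using rarefaction p c_pos by (simp add: f_wave_def)
  qed
qed

lemma f_riemann_root_unique:
  assumes "rho V_L > 0" "p11 V_L > 0" "rho V_R > 0" "p11 V_R > 0"
    and "p > 0" "q > 0" "f_riemann p V_L V_R = 0" "f_riemann q V_L V_R = 0"
  shows "p = q"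
proof -
  have "f_riemann p V_L V_R < f_riemann q V_L V_R" if "0 < p" "p < q" for p q
    using f_wave_strict_mono[of V_L p q] f_wave_strict_mono[of V_R p q] assms(1-4) that
    by (simp add: f_riemann_def)
  then show ?thesis
    using assms(5-8) by (metis less_irrefl linorder_neqE_linordered_idom)
qed


section \<open>The intermediate pressure and velocity\<close>

theorem theorem4p1:
  fixes V :: "real \<Rightarrow> real \<Rightarrow> state"
    and V_L V_R :: state
    and u1s p11s :: real
  assumes "admissible V_L" and "admissible V_R"
    and "riemann_solution V V_L V_R u1s p11s"
  shows "p11s > 0 \<and> f_riemann p11s V_L V_R = 0 \<and>
         (\<forall>p>0. f_riemann p V_L V_R = 0 \<longrightarrow> p = p11s) \<and>
         u1s = (u1 V_L + u1 V_R) / 2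
               + (f_wave p11s V_R - f_wave p11s V_L) / 2"
proof -
  obtain W V1 V2 V3 V4 a1 b1 s2 s5 a6 b6 where
    middle: "\<forall>Z\<in>{V1, V2, V3, V4}. u1 Z = u1s \<and> p11 Z = p11s"
    and waves: "nonlinear_wave lambda1 invariants1 W a1 b1 V_L V1"
      "nonlinear_wave lambda6 invariants6 W a6 b6 V4 V_R"
    and W_pos: "\<forall>\<xi>. rho (W \<xi>) > 0 \<and> p11 (W \<xi>) > 0"
    and V1: "\<forall>\<xi>\<in>{b1<..<s2}. W \<xi> = V1" and V4: "\<forall>\<xi>\<in>{s5<..<a6}. W \<xi> = V4"
    and order: "b1 < s2" "s5 < a6"
    using assms(3) unfolding riemann_solution_def
    by (elim conjE exE) (rule that; assumption)
  have pos: "rho V_L > 0" "p11 V_L > 0" "rho V_R > 0" "p11 V_R > 0"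
    using assms(1,2) by (simp_all add: admissible_def)
  (* The sectors next to the nonlinear waves are nonempty, so positivity of the
     profile W passes to the states V1 and V4. *)
  have "W ((b1 + s2) / 2) = V1" "W ((s5 + a6) / 2) = V4"
    using V1 V4 order by simp_all
  then have pos_mid: "rho V1 > 0" "p11 V1 > 0" "rho V4 > 0"
    using W_pos by metis+
  have left: "u1s = u1 V_L - f_wave p11s V_L"
    using velocity_behind_1_wave[OF waves(1)] pos pos_mid middle by simp
  have right: "u1s = u1 V_R + f_wave p11s V_R"
    using velocity_behind_6_wave[OF waves(2)] pos pos_mid middle by simp
  have p_pos: "p11s > 0" using pos_mid middle by simp
  have root: "f_riemann p11s V_L V_R = 0"
    using left right by (simp add: f_riemann_def)
  have "u1s = (u1 V_L + u1 V_R) / 2 + (f_wave p11s V_R - f_wave p11s V_L) / 2"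
    using left right by argo
  then show ?thesis
    using p_pos root f_riemann_root_unique[OF pos _ p_pos _ root] by blast
qed

end
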